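(* Let $G$ be a multiplicative Lie algebra. Then there exists a stem multiplicative Lie algebra $H$ such that $G$ and $H$ are isoclinic.
   Context: A multiplicative Lie algebra is a group $(G,\cdot)$ with a binary operation $\star$ satisfying, for all $x,y,z\in G$ (with ${}^{x}y=xyx^{-1}$): $x\star x=1$; $x\star(yz)=(x\star y)\,{}^{y}(x\star z)$; $(xy)\star z={}^{x}(y\star z)\,(x\star z)$; $((x\star y)\star{}^{y}z)((y\star z)\star{}^{z}x)((z\star x)\star{}^{x}y)=1$; ${}^{z}(x\star y)=({}^{z}x)\star({}^{z}y)$. A homomorphism is a group homomorphism preserving $\star$. An ideal is a normal subgroup $I$ with $x\star y\in I$ (and $y\star x\in I$) for all $x\in G$, $y\in I$; quotients $G/I$ are then multiplicative Lie algebras. Write $[x,y]=xyx^{-1}y^{-1}$. $[G,G]$ is the commutator subgroup, $G\star G$ is the ideal generated by all $x\star y$, and ${}^{M}[G,G]:=[G,G](G\star G)$ is the multiplicative commutator of $G$. $Z(G)$ is the group centre, $LZ(G)=\{x\in G: x\star y=1\ \forall y\in G\}$, and $\mathcal{Z}(G):=Z(G)\cap LZ(G)$ is an ideal of $G$ (the multiplicative Lie center). Two multiplicative Lie algebras $G,H$ are isoclinic (written $G\sim_{ml}H$) if there are multiplicative Lie algebra isomorphisms $\lambda:G/\mathcal{Z}(G)\to H/\mathcal{Z}(H)$ and $\mu:{}^{M}[G,G]\to{}^{M}[H,H]$ such that, whenever $\lambda(a\mathcal{Z}(G))=a'\mathcal{Z}(H)$ and $\lambda(b\mathcal{Z}(G))=b'\mathcal{Z}(H)$,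 one has $\mu([a,b])=[a',b']$ and $\mu(a\star b)=a'\star b'$. (This is independent of the choice of representatives.) A multiplicative Lie algebra $H$ is called stem if $\mathcal{Z}(H)\subseteq{}^{M}[H,H]$. *)

theory Defs
  imports "HOL-Algebra.Algebra"
begin

record 'a mult_lie = "'a monoid" +
  lstar :: "'a \<Rightarrow> 'a \<Rightarrow> 'a"  (infixl \<open>\<star>\<index>\<close> 70)

definition lconj :: "('a, 'm) monoid_scheme \<Rightarrow> 'a \<Rightarrow> 'a \<Rightarrow> 'a" where
  "lconj G x y = x \<otimes>\<^bsub>G\<^esub> y \<otimes>\<^bsub>G\<^esub> inv\<^bsub>G\<^esub> x"

definition commutator :: "('a, 'm) monoid_scheme \<Rightarrow> 'a \<Rightarrow> 'a \<Rightarrow> 'a" where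
  "commutator G x y = x \<otimes>\<^bsub>G\<^esub> y \<otimes>\<^bsub>G\<^esub> inv\<^bsub>G\<^esub> x \<otimes>\<^bsub>G\<^esub> inv\<^bsub>G\<^esub> y"

locale mult_lie_algebra = group G for G :: "('a, 'm) mult_lie_scheme" (structure) +
  assumes lstar_closed:
      "\<lbrakk>x \<in> carrier G; y \<in> carrier G\<rbrakk> \<Longrightarrow> x \<star> y \<in> carrier G"
    and lstar_self:
      "x \<in> carrier G \<Longrightarrow> x \<star> x = \<one>"
    and lstar_mult_right:
      "\<lbrakk>x \<in> carrier G; y \<in> carrier G; z \<in> carrier G\<rbrakk>
        \<Longrightarrow> x \<star> (y \<otimes> z) = (x \<star> y) \<otimes> lconj G y (x \<star> z)"
    and lstar_mult_left:
      "\<lbrakk>x \<in> carrier G; y \<in> carrier G; z \<in> carrier G\<rbrakk>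
        \<Longrightarrow> (x \<otimes> y) \<star> z = lconj G x (y \<star> z) \<otimes> (x \<star> z)"
    and lstar_jacobi:
      "\<lbrakk>x \<in> carrier G; y \<in> carrier G; z \<in> carrier G\<rbrakk>
        \<Longrightarrow> ((x \<star> y) \<star> lconj G y z) \<otimes> ((y \<star> z) \<star> lconj G z x) \<otimes> ((z \<star> x) \<star> lconj G x y) = \<one>"
    and lconj_lstar:
      "\<lbrakk>x \<in> carrier G; y \<in> carrier G; z \<in> carrier G\<rbrakk>
        \<Longrightarrow> lconj G z (x \<star> y) = lconj G z x \<star> lconj G z y"

definition mlie_iso :: "('a, 'm) mult_lie_scheme \<Rightarrow> ('b, 'n) mult_lie_scheme \<Rightarrow> ('a \<Rightarrow> 'b) set" where
  "mlie_iso G H =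
    {h \<in> iso G H. \<forall>x\<in>carrier G. \<forall>y\<in>carrier G. h (x \<star>\<^bsub>G\<^esub> y) = h x \<star>\<^bsub>H\<^esub> h y}"

definition mlie_ideal :: "'a set \<Rightarrow> ('a, 'm) mult_lie_scheme \<Rightarrow> bool" where
  "mlie_ideal I G \<longleftrightarrow>
    I \<lhd> G \<and> (\<forall>x\<in>carrier G. \<forall>y\<in>I. x \<star>\<^bsub>G\<^esub> y \<in> I \<and> y \<star>\<^bsub>G\<^esub> x \<in> I)"

definition mlie_ideal_generated :: "('a, 'm) mult_lie_scheme \<Rightarrow> 'a set \<Rightarrow> 'a set" where
  "mlie_ideal_generated G S = \<Inter>{I. mlie_ideal I G \<and> S \<subseteq> I}"

text \<open>As for multiplication in \<^const>\<open>FactRing\<close>, the operation on cosets is a union over all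
  representatives; when \<open>I\<close> is an ideal, all the united cosets coincide.\<close>

definition mlie_quotient :: "('a, 'm) mult_lie_scheme \<Rightarrow> 'a set \<Rightarrow> 'a set mult_lie" where
  "mlie_quotient G I =
    \<lparr>carrier = rcosets\<^bsub>G\<^esub> I, monoid.mult = set_mult G, one = I,
     lstar = (\<lambda>A B. \<Union>a\<in>A. \<Union>b\<in>B. I #>\<^bsub>G\<^esub> (a \<star>\<^bsub>G\<^esub> b))\<rparr>"

definition star_ideal :: "('a, 'm) mult_lie_scheme \<Rightarrow> 'a set" where
  "star_ideal G = mlie_ideal_generated G {x \<star>\<^bsub>G\<^esub> y |x y. x \<in> carrier G \<and> y \<in> carrier G}"

definition mlie_commutator :: "('a, 'm) mult_lie_scheme \<Rightarrow> 'a set" where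
  "mlie_commutator G = derived G (carrier G) <#>\<^bsub>G\<^esub> star_ideal G"

definition group_center :: "('a, 'm) monoid_scheme \<Rightarrow> 'a set" where
  "group_center G = {x \<in> carrier G. \<forall>y\<in>carrier G. x \<otimes>\<^bsub>G\<^esub> y = y \<otimes>\<^bsub>G\<^esub> x}"

definition lie_center :: "('a, 'm) mult_lie_scheme \<Rightarrow> 'a set" where
  "lie_center G = {x \<in> carrier G. \<forall>y\<in>carrier G. x \<star>\<^bsub>G\<^esub> y = \<one>\<^bsub>G\<^esub>}"

definition mlie_center :: "('a, 'm) mult_lie_scheme \<Rightarrow> 'a set" where
  "mlie_center G = group_center G \<inter> lie_center G"

text \<open>Cosets are the library's right cosets; they agree with left cosets since
  \<open>mlie_center G\<close> is central.\<close>

definition isoclinic :: "('a, 'm) mult_lie_scheme \<Rightarrow> ('b, 'n) mult_lie_scheme \<Rightarrow> bool" where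
  "isoclinic G H \<longleftrightarrow>
    (\<exists>f \<in> mlie_iso (mlie_quotient G (mlie_center G)) (mlie_quotient H (mlie_center H)).
     \<exists>\<mu> \<in> mlie_iso (G\<lparr>carrier := mlie_commutator G\<rparr>) (H\<lparr>carrier := mlie_commutator H\<rparr>).
       \<forall>a\<in>carrier G. \<forall>b\<in>carrier G. \<forall>a'\<in>carrier H. \<forall>b'\<in>carrier H.
         f (mlie_center G #>\<^bsub>G\<^esub> a) = mlie_center H #>\<^bsub>H\<^esub> a' \<longrightarrow>
         f (mlie_center G #>\<^bsub>G\<^esub> b) = mlie_center H #>\<^bsub>H\<^esub> b' \<longrightarrow>
           \<mu> (commutator G a b) = commutator H a' b' \<and>
           \<mu> (a \<star>\<^bsub>G\<^esub> b) = a' \<star>\<^bsub>H\<^esub> b')"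

definition stem :: "('a, 'm) mult_lie_scheme \<Rightarrow> bool" where
  "stem H \<longleftrightarrow> mlie_center H \<subseteq> mlie_commutator H"

end

theory Submission
  imports Defs
begin

text \<open>Let \<open>M\<close> be the multiplicative commutator of \<open>G\<close>, let \<open>F\<close> be the free abelian group on the
  elements of \<open>G\<close> with trivial star, and let \<open>K\<close> be the fibre product of \<open>G\<close> and \<open>F\<close> over \<open>G/M\<close>.
  The multiplicative commutator of \<open>K\<close> is \<open>M \<times> 0\<close>. An epimorphism whose kernel meets the
  multiplicative commutator trivially is an isoclinism, so \<open>K\<close> is isoclinic to \<open>G\<close>.
  The projection from the center of \<open>K\<close> to \<open>F\<close> has free abelian image, so its kernel, which lies
  in \<open>M \<times> 0\<close>, has a complement \<open>C\<close> in the center. Then \<open>K/C\<close> is isoclinic to \<open>K\<close>, and its center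
  is the image of that kernel, so it is stem.\<close>

subsection \<open>Centers and commutators\<close>

context mult_lie_algebra
begin

section \<open>Conjugation, commutators and antisymmetry of the star operation\<close>

lemma lconj_closed [simp]:
  assumes "x \<in> carrier G" "y \<in> carrier G" shows "lconj G x y \<in> carrier G"
  using assms by (simp add: lconj_def)

declare lstar_closed [simp]

lemma commutator_closed [simp]:
  assumes "x \<in> carrier G" "y \<in> carrier G" shows "commutator G x y \<in> carrier G"
  using assms by (simp add: commutator_def)

lemma lconj_one_right [simp]: "x \<in> carrier G \<Longrightarrow> lconj G x \<one> = \<one>"
  by (simp add: lconj_def)

lemma lconj_one_left [simp]: "x \<in> carrier G \<Longrightarrow> lconj G \<one> x = x"
  by (simp add: lconj_def)

lemma lconj_mult:
  assumes "x \<in> carrier G" "y \<in> carrier G" "z \<in> carrier G"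
  shows "lconj G x (y \<otimes> z) = lconj G x y \<otimes> lconj G x z"
  using assms by (simp add: lconj_def m_assoc inv_solve_left)

lemma lconj_eq_one_iff:
  assumes "x \<in> carrier G" "y \<in> carrier G"
  shows "lconj G x y = \<one> \<longleftrightarrow> y = \<one>"
  using assms by (metis inv_closed l_cancel_one' lconj_def m_closed r_inv right_cancel)

lemma lconj_eq_commutator:
  assumes "x \<in> carrier G" "y \<in> carrier G"
  shows "lconj G x y = commutator G x y \<otimes> y"
  using assms by (simp add: lconj_def commutator_def m_assoc)

lemma commutator_eq:
  assumes "x \<in> carrier G" "y \<in> carrier G"
  shows "commutator G x y = (x \<otimes> y) \<otimes> inv (y \<otimes> x)"
  using assms by (simp add: commutator_def inv_mult_group m_assoc)

lemma commutator_eq_one_iff: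
  assumes "x \<in> carrier G" "y \<in> carrier G"
  shows "commutator G x y = \<one> \<longleftrightarrow> x \<otimes> y = y \<otimes> x"
  using assms commutator_eq by (metis inv_closed inv_equality inv_inv m_closed r_inv)

text \<open>Expanding \<open>(x \<otimes> y) \<star> (x \<otimes> y) = \<one>\<close> by both
  multiplication laws removes the terms \<open>x \<star> x\<close> and \<open>y \<star> y\<close>;
  what remains is a conjugate by \<open>x\<close> of the product in question.\<close>

lemma lstar_antisym:
  assumes "x \<in> carrier G" "y \<in> carrier G"
  shows "(y \<star> x) \<otimes> (x \<star> y) = \<one>"
proof -
  have "\<one> = (x \<otimes> y) \<star> (x \<otimes> y)"
    using assms by (simp add: lstar_self)
  also have "\<dots> = lconj G x (y \<star> (x \<otimes> y)) \<otimes> (x \<star> (x \<otimes> y))"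
    using assms by (simp add: lstar_mult_left)
  also have "\<dots> = lconj G x ((y \<star> x) \<otimes> (x \<star> y))"
    using assms by (simp add: lstar_mult_right lstar_self lconj_mult)
  finally show ?thesis
    using assms by (metis lconj_eq_one_iff lstar_closed m_closed)
qed

text \<open>Makes the condition in \<open>lie_center\<close>, which is stated for one side only,
  symmetric.\<close>

lemma lstar_eq_one_commute:
  assumes "x \<in> carrier G" "y \<in> carrier G" "x \<star> y = \<one>"
  shows "y \<star> x = \<one>"
  using assms lstar_antisym by (metis lstar_closed r_one)

lemma lstar_one_left [simp]:
  assumes "x \<in> carrier G" shows "\<one> \<star> x = \<one>"
  using lstar_mult_left[of \<one> \<one> x] assms by simp

section \<open>The multiplicative Lie center\<close>

lemma mlie_center_carrier: "x \<in> mlie_center G \<Longrightarrow> x \<in> carrier G"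
  by (simp add: mlie_center_def group_center_def)

lemma mlie_center_comm:
  "\<lbrakk>x \<in> mlie_center G; y \<in> carrier G\<rbrakk> \<Longrightarrow> x \<otimes> y = y \<otimes> x"
  by (simp add: mlie_center_def group_center_def)

lemma mlie_center_lstar_left: "\<lbrakk>x \<in> mlie_center G; y \<in> carrier G\<rbrakk> \<Longrightarrow> x \<star> y = \<one>"
  by (simp add: mlie_center_def lie_center_def)

lemma mlie_center_lstar_right: "\<lbrakk>x \<in> mlie_center G; y \<in> carrier G\<rbrakk> \<Longrightarrow> y \<star> x = \<one>"
  by (meson lstar_eq_one_commute mlie_center_carrier mlie_center_lstar_left)

lemma mlie_center_lconj: "\<lbrakk>x \<in> mlie_center G; y \<in> carrier G\<rbrakk> \<Longrightarrow> lconj G x y = y"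
  unfolding lconj_def by (metis inv_solve_right' m_closed mlie_center_carrier mlie_center_comm)

text \<open>Expresses centrality by the triviality of elements of \<open>mlie_commutator G\<close>;
  in this form it can be tested through a map that is injective there.\<close>

lemma mlie_center_iff:
  "x \<in> mlie_center G \<longleftrightarrow>
     x \<in> carrier G \<and> (\<forall>y\<in>carrier G. commutator G x y = \<one> \<and> x \<star> y = \<one>)"
  by (auto simp: mlie_center_def group_center_def lie_center_def commutator_eq_one_iff)

lemma mlie_center_subgroup: "subgroup (mlie_center G) G"
proof (rule subgroupI)
  show "mlie_center G \<subseteq> carrier G"
    using mlie_center_carrier by blast
  have "\<one> \<in> mlie_center G"
    by (simp add: mlie_center_def group_center_def lie_center_def)
  then show "mlie_center G \<noteq> {}" by blast
  show "inv a \<in> mlie_center G" if a: "a \<in> mlie_center G" for a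
  proof -
    have c: "a \<in> carrier G" by (rule mlie_center_carrier[OF a])
    have "inv a \<star> y = \<one>" if y: "y \<in> carrier G" for y
      using lstar_mult_left[of "inv a" a y] c y mlie_center_lstar_left[OF a y] by simp
    moreover have "inv a \<otimes> y = y \<otimes> inv a" if y: "y \<in> carrier G" for y
      using c y mlie_center_comm[OF a y] by (metis inv_closed inv_solve_left inv_solve_right m_assoc m_closed)
    ultimately show ?thesis
      using c by (simp add: mlie_center_def group_center_def lie_center_def)
  qed
  show "a \<otimes> b \<in> mlie_center G" if a: "a \<in> mlie_center G" and b: "b \<in> mlie_center G" for a b
  proof -
    have c: "a \<in> carrier G" "b \<in> carrier G" using a b mlie_center_carrier by auto
    have "(a \<otimes> b) \<star> y = \<one>" if y: "y \<in> carrier G" for y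
      using c y a b by (simp add: lstar_mult_left mlie_center_lstar_left)
    moreover have "(a \<otimes> b) \<otimes> y = y \<otimes> (a \<otimes> b)" if y: "y \<in> carrier G" for y
      using c y a b by (metis m_assoc mlie_center_comm)
    ultimately show ?thesis
      using c by (simp add: mlie_center_def group_center_def lie_center_def)
  qed
qed

lemma mlie_center_normal: "mlie_center G \<lhd> G"
proof (rule normal_invI[OF mlie_center_subgroup])
  fix x c assume "x \<in> carrier G" "c \<in> mlie_center G"
  then have "x \<otimes> c \<otimes> inv x = c"
    by (metis inv_solve_right' m_closed mlie_center_carrier mlie_center_comm)
  then show "x \<otimes> c \<otimes> inv x \<in> mlie_center G"
    using \<open>c \<in> mlie_center G\<close> by simp
qed

text \<open>Central elements have trivial stars and conjugate trivially, so both multiplication laws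
  collapse. The star is thus well defined on cosets of the center.\<close>

lemma lstar_center_mult:
  assumes "c \<in> mlie_center G" "d \<in> mlie_center G" "x \<in> carrier G" "y \<in> carrier G"
  shows "(c \<otimes> x) \<star> (d \<otimes> y) = x \<star> y"
  using assms assms(1,2)[THEN mlie_center_carrier]
  by (simp add: lstar_mult_left lstar_mult_right mlie_center_lconj mlie_center_lstar_left mlie_center_lstar_right)

lemma commutator_center_mult:
  assumes c: "c \<in> mlie_center G" and d: "d \<in> mlie_center G"
    and x: "x \<in> carrier G" and y: "y \<in> carrier G"
  shows "commutator G (c \<otimes> x) (d \<otimes> y) = commutator G x y"
proof -
  note cd = c[THEN mlie_center_carrier] d[THEN mlie_center_carrier]
  \<comment> \<open>Both orders of multiplication acquire the same central factor
    \<open>c \<otimes> d\<close>, so the commutator is merely conjugated by it, which changes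
    nothing.\<close>
  have "(c \<otimes> x) \<otimes> (d \<otimes> y) = (c \<otimes> d) \<otimes> (x \<otimes> y)"
    using cd x y mlie_center_comm[OF d x] by (metis m_assoc m_closed)
  moreover have "(d \<otimes> y) \<otimes> (c \<otimes> x) = (c \<otimes> d) \<otimes> (y \<otimes> x)"
    using cd x y mlie_center_comm[OF c y] mlie_center_comm[OF c] by (metis m_assoc m_closed)
  ultimately have "commutator G (c \<otimes> x) (d \<otimes> y) = lconj G (c \<otimes> d) (commutator G x y)"
    using cd x y by (simp add: commutator_eq lconj_def inv_mult_group m_assoc)
  then show ?thesis
    using mlie_center_lconj[OF subgroup.m_closed[OF mlie_center_subgroup c d]] x y by simp
qed

section \<open>The multiplicative commutator as a generated subgroup\<close>

definition mlie_commutator_gens :: "'a set" where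
  "mlie_commutator_gens =
     {commutator G x y |x y. x \<in> carrier G \<and> y \<in> carrier G} \<union>
     {x \<star> y |x y. x \<in> carrier G \<and> y \<in> carrier G}"

lemma mlie_commutator_gens_carrier: "mlie_commutator_gens \<subseteq> carrier G"
  by (auto simp: mlie_commutator_gens_def)

lemma mlie_commutator_gensI:
  assumes "x \<in> carrier G" "y \<in> carrier G"
  shows "commutator G x y \<in> mlie_commutator_gens" "x \<star> y \<in> mlie_commutator_gens"
  using assms by (auto simp: mlie_commutator_gens_def)

text \<open>Containing all commutators makes a subgroup normal, so no closure under conjugation is
  needed to generate \<^term>\<open>mlie_commutator G\<close>.\<close>

lemma mlie_ideal_of_subgroup:
  assumes "subgroup I G" "mlie_commutator_gens \<subseteq> I"
  shows "mlie_ideal I G"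
proof -
  interpret I: subgroup I G by fact
  have "x \<otimes> h \<otimes> inv x \<in> I" if "x \<in> carrier G" "h \<in> I" for x h
  proof -
    have "commutator G x h \<in> I"
      using assms(2) that mlie_commutator_gensI(1)[of x h] by auto
    then show ?thesis
      using lconj_eq_commutator[of x h] that by (simp add: lconj_def)
  qed
  moreover have "x \<star> y \<in> I" if "x \<in> carrier G" "y \<in> carrier G" for x y
    using assms(2) that mlie_commutator_gensI(2)[of x y] by auto
  ultimately show ?thesis
    using assms by (simp add: mlie_ideal_def normal_inv_iff)
qed

text \<open>The generated subgroup is an ideal, so it contains \<open>star_ideal G\<close> as well
  as the derived subgroup. Conversely, normality of the derived subgroup makes the product of the
  two a subgroup, and it contains all generators. A generated subgroup is easy to follow along
  homomorphisms.\<close>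

lemma mlie_commutator_eq_generate: "mlie_commutator G = generate G mlie_commutator_gens"
proof
  let ?T = "generate G mlie_commutator_gens"
  let ?S = "{x \<star> y |x y. x \<in> carrier G \<and> y \<in> carrier G}"
  have sub: "subgroup ?T G"
    by (rule generate_is_subgroup[OF mlie_commutator_gens_carrier])
  have gens: "mlie_commutator_gens \<subseteq> ?T"
    by (auto intro: generate.incl)
  have "mlie_ideal ?T G"
    by (rule mlie_ideal_of_subgroup[OF sub gens])
  then have "star_ideal G \<subseteq> ?T"
    using gens mlie_commutator_gensI(2) unfolding star_ideal_def mlie_ideal_generated_def
    by (intro Inter_lower) auto
  moreover have "derived_set G (carrier G) \<subseteq> mlie_commutator_gens"
    by (auto simp: mlie_commutator_gens_def commutator_def)
  then have "derived G (carrier G) \<subseteq> ?T"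
    unfolding derived_def by (rule mono_generate)
  ultimately show "mlie_commutator G \<subseteq> ?T"
    unfolding mlie_commutator_def set_mult_def using subgroup.m_closed[OF sub] by blast
  let ?Is = "{I. mlie_ideal I G \<and> ?S \<subseteq> I}"
  \<comment> \<open>The intersection defining \<open>star_ideal G\<close> thus runs over a nonempty
    family and is a subgroup.\<close>
  have "mlie_ideal (carrier G) G"
    by (rule mlie_ideal_of_subgroup[OF subgroup_self mlie_commutator_gens_carrier])
  then have "carrier G \<in> ?Is" by auto
  then have S: "subgroup (star_ideal G) G"
    unfolding star_ideal_def mlie_ideal_generated_def
    by (intro subgroups_Inter) (auto simp: mlie_ideal_def normal_imp_subgroup)
  have SS: "?S \<subseteq> star_ideal G"
    unfolding star_ideal_def mlie_ideal_generated_def by blast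
  have D: "derived G (carrier G) \<lhd> G"
    by (rule derived_self_is_normal)
  have sub': "subgroup (mlie_commutator G) G"
    unfolding mlie_commutator_def by (rule mult_norm_subgroup[OF D S])
  have "commutator G x y \<in> mlie_commutator G" if "x \<in> carrier G" "y \<in> carrier G" for x y
  proof -
    have "commutator G x y \<in> derived G (carrier G)"
      unfolding derived_def commutator_def using that by (blast intro: generate.incl)
    moreover have "\<one> \<in> star_ideal G" by (rule subgroup.one_closed[OF S])
    ultimately have "commutator G x y \<otimes> \<one> \<in> mlie_commutator G"
      unfolding mlie_commutator_def set_mult_def by blast
    then show ?thesis using that by simp
  qed
  moreover have "x \<star> y \<in> mlie_commutator G" if "x \<in> carrier G" "y \<in> carrier G" for x y
  proof -
    have "\<one> \<in> derived G (carrier G)"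
      using D normal_imp_subgroup subgroup.one_closed by blast
    moreover have "x \<star> y \<in> star_ideal G" using SS that by blast
    ultimately have "\<one> \<otimes> (x \<star> y) \<in> mlie_commutator G"
      unfolding mlie_commutator_def set_mult_def by blast
    then show ?thesis using that by simp
  qed
  ultimately have "mlie_commutator_gens \<subseteq> mlie_commutator G"
    by (auto simp: mlie_commutator_gens_def)
  then show "?T \<subseteq> mlie_commutator G"
    by (rule generate_subgroup_incl[OF _ sub'])
qed

lemma mlie_commutator_subgroup: "subgroup (mlie_commutator G) G"
  by (simp add: mlie_commutator_eq_generate generate_is_subgroup mlie_commutator_gens_carrier)

lemma commutator_in_mlie_commutator:
  "\<lbrakk>x \<in> carrier G; y \<in> carrier G\<rbrakk> \<Longrightarrow> commutator G x y \<in> mlie_commutator G"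
  unfolding mlie_commutator_eq_generate by (intro generate.incl mlie_commutator_gensI)

lemma lstar_in_mlie_commutator:
  "\<lbrakk>x \<in> carrier G; y \<in> carrier G\<rbrakk> \<Longrightarrow> x \<star> y \<in> mlie_commutator G"
  unfolding mlie_commutator_eq_generate by (intro generate.incl mlie_commutator_gensI)

lemma mlie_commutator_normal: "mlie_commutator G \<lhd> G"
proof -
  have "mlie_commutator_gens \<subseteq> mlie_commutator G"
    by (auto simp: mlie_commutator_eq_generate intro: generate.incl)
  then show ?thesis
    using mlie_ideal_of_subgroup[OF mlie_commutator_subgroup] by (simp add: mlie_ideal_def)
qed

lemma mlie_quotient_lstar:
  assumes "a \<in> carrier G" "b \<in> carrier G"
  shows "(mlie_center G #> a) \<star>\<^bsub>mlie_quotient G (mlie_center G)\<^esub> (mlie_center G #> b)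
       = mlie_center G #> (a \<star> b)"
proof -
  \<comment> \<open>The cosets are nonempty, so a union over them of equal sets is that set.\<close>
  have ne: "a \<in> mlie_center G #> a" "b \<in> mlie_center G #> b"
    using assms mlie_center_subgroup rcos_self by auto
  have "x \<star> y = a \<star> b" if "x \<in> mlie_center G #> a" "y \<in> mlie_center G #> b" for x y
    using that assms by (auto simp: r_coset_def lstar_center_mult)
  then have "(\<Union>x\<in>mlie_center G #> a. \<Union>y\<in>mlie_center G #> b. mlie_center G #> (x \<star> y))
      = (\<Union>x\<in>mlie_center G #> a. \<Union>y\<in>mlie_center G #> b. mlie_center G #> (a \<star> b))"
    by simp
  also have "\<dots> = mlie_center G #> (a \<star> b)"
    using ne by auto
  finally show ?thesis
    by (simp add: mlie_quotient_def)
qed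

end

subsection \<open>Isoclinisms from spans of epimorphisms\<close>

text \<open>The last assumption makes the kernel central: for \<open>x\<close> in it, every
  commutator and star with \<open>x\<close> lies both in the kernel and in
  \<open>mlie_commutator K\<close>, hence is trivial.\<close>

locale isoclinic_epi = dom: mult_lie_algebra K + cod: mult_lie_algebra G
  for K :: "('a, 'm) mult_lie_scheme" and G :: "('b, 'n) mult_lie_scheme" and p +
  assumes hom: "p \<in> hom K G"
    and p_lstar: "\<lbrakk>x \<in> carrier K; y \<in> carrier K\<rbrakk> \<Longrightarrow> p (x \<star>\<^bsub>K\<^esub> y) = p x \<star>\<^bsub>G\<^esub> p y"
    and surj: "p ` carrier K = carrier G"
    and ker_trivial: "\<lbrakk>x \<in> mlie_commutator K; p x = \<one>\<^bsub>G\<^esub>\<rbrakk> \<Longrightarrow> x = \<one>\<^bsub>K\<^esub>"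

sublocale isoclinic_epi \<subseteq> group_hom K G p
  by unfold_locales (rule hom)

context isoclinic_epi
begin

lemma p_commutator:
  assumes "x \<in> carrier K" "y \<in> carrier K"
  shows "p (commutator K x y) = commutator G (p x) (p y)"
  using assms by (simp add: commutator_def)

text \<open>By surjectivity \<open>p\<close> maps the generators onto the generators, and the image
  of a generated subgroup is generated by the image.\<close>

lemma image_mlie_commutator: "p ` mlie_commutator K = mlie_commutator G"
proof -
  have 1: "p ` {commutator K x y |x y. x \<in> carrier K \<and> y \<in> carrier K}
      = {commutator G x y |x y. x \<in> carrier G \<and> y \<in> carrier G}" (is "p ` ?A = ?B")
  proof
    show "p ` ?A \<subseteq> ?B"
      using p_commutator by fastforce
    show "?B \<subseteq> p ` ?A"
    proof
      fix z assume "z \<in> ?B"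
      then obtain x y where "x \<in> carrier K" "y \<in> carrier K" "z = commutator G (p x) (p y)"
        by (auto simp flip: surj)
      then show "z \<in> p ` ?A"
        by (auto intro!: image_eqI[of _ _ "commutator K x y"] simp: p_commutator)
    qed
  qed
  have 2: "p ` {x \<star>\<^bsub>K\<^esub> y |x y. x \<in> carrier K \<and> y \<in> carrier K}
      = {x \<star>\<^bsub>G\<^esub> y |x y. x \<in> carrier G \<and> y \<in> carrier G}" (is "p ` ?A = ?B")
  proof
    show "p ` ?A \<subseteq> ?B"
      using p_lstar by fastforce
    show "?B \<subseteq> p ` ?A"
    proof
      fix z assume "z \<in> ?B"
      then obtain x y where "x \<in> carrier K" "y \<in> carrier K" "z = p x \<star>\<^bsub>G\<^esub> p y"
        by (auto simp flip: surj)
      then show "z \<in> p ` ?A"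
        by (auto intro!: image_eqI[of _ _ "x \<star>\<^bsub>K\<^esub> y"] simp: p_lstar)
    qed
  qed
  have "p ` dom.mlie_commutator_gens = cod.mlie_commutator_gens"
    unfolding dom.mlie_commutator_gens_def cod.mlie_commutator_gens_def image_Un 1 2 ..
  then show ?thesis
    using generate_img[OF dom.mlie_commutator_gens_carrier]
    by (simp add: dom.mlie_commutator_eq_generate cod.mlie_commutator_eq_generate)
qed

lemma inj_on_mlie_commutator: "inj_on p (mlie_commutator K)"
proof
  fix x y assume xy: "x \<in> mlie_commutator K" "y \<in> mlie_commutator K" "p x = p y"
  interpret M: subgroup "mlie_commutator K" K by (rule dom.mlie_commutator_subgroup)
  have "p (x \<otimes>\<^bsub>K\<^esub> inv\<^bsub>K\<^esub> y) = \<one>\<^bsub>G\<^esub>"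
    using xy by simp
  then have "x \<otimes>\<^bsub>K\<^esub> inv\<^bsub>K\<^esub> y = \<one>\<^bsub>K\<^esub>"
    using xy by (intro ker_trivial) auto
  then show "x = y"
    using xy by (metis M.mem_carrier dom.inv_equality dom.inv_inv dom.inv_closed)
qed

text \<open>If \<open>p k\<close> is central, the commutators and stars of \<open>k\<close> map to
  the identity and lie in \<open>mlie_commutator K\<close>, so they are trivial. The converse uses
  that \<open>p\<close> is onto.\<close>

lemma mlie_center_iff:
  assumes "k \<in> carrier K"
  shows "p k \<in> mlie_center G \<longleftrightarrow> k \<in> mlie_center K"
proof
  assume k: "p k \<in> mlie_center G"
  have "commutator K k y = \<one>\<^bsub>K\<^esub>" "k \<star>\<^bsub>K\<^esub> y = \<one>\<^bsub>K\<^esub>" if "y \<in> carrier K" for y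
    using that assms k
    by (auto intro!: ker_trivial dom.commutator_in_mlie_commutator dom.lstar_in_mlie_commutator
        simp: p_commutator p_lstar cod.mlie_center_iff)
  then show "k \<in> mlie_center K"
    using assms by (simp add: dom.mlie_center_iff)
next
  assume k: "k \<in> mlie_center K"
  have "commutator G (p k) y = \<one>\<^bsub>G\<^esub> \<and> p k \<star>\<^bsub>G\<^esub> y = \<one>\<^bsub>G\<^esub>" if y: "y \<in> carrier G" for y
  proof -
    obtain x where "x \<in> carrier K" "y = p x" using surj y by auto
    then show ?thesis
      using k assms by (metis dom.mlie_center_iff hom_one p_commutator p_lstar)
  qed
  then show "p k \<in> mlie_center G"
    using assms by (simp add: cod.mlie_center_iff)
qed

lemma mlie_center_rcos_iff:
  assumes "k \<in> carrier K" "l \<in> carrier K"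
  shows "p l \<in> mlie_center G #>\<^bsub>G\<^esub> p k \<longleftrightarrow> l \<in> mlie_center K #>\<^bsub>K\<^esub> k"
proof -
  have "p l \<in> mlie_center G #>\<^bsub>G\<^esub> p k \<longleftrightarrow> p l \<otimes>\<^bsub>G\<^esub> inv\<^bsub>G\<^esub> p k \<in> mlie_center G"
    using assms cod.mlie_center_subgroup by (simp add: subgroup.rcos_module cod.is_group)
  also have "\<dots> \<longleftrightarrow> l \<otimes>\<^bsub>K\<^esub> inv\<^bsub>K\<^esub> k \<in> mlie_center K"
    using assms mlie_center_iff[of "l \<otimes>\<^bsub>K\<^esub> inv\<^bsub>K\<^esub> k"] by simp
  also have "\<dots> \<longleftrightarrow> l \<in> mlie_center K #>\<^bsub>K\<^esub> k"
    using assms dom.mlie_center_subgroup by (simp add: subgroup.rcos_module dom.is_group)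
  finally show ?thesis .
qed

lemma mlie_center_rcos_eq_iff:
  assumes "k \<in> carrier K" "l \<in> carrier K"
  shows "mlie_center G #>\<^bsub>G\<^esub> p k = mlie_center G #>\<^bsub>G\<^esub> p l \<longleftrightarrow>
    mlie_center K #>\<^bsub>K\<^esub> k = mlie_center K #>\<^bsub>K\<^esub> l"
  using assms mlie_center_rcos_iff[OF assms]
  by (metis cod.mlie_center_subgroup cod.rcos_self cod.repr_independence dom.mlie_center_subgroup
      dom.rcos_self dom.repr_independence hom_closed)

lemma image_mlie_center_rcos:
  assumes "k \<in> carrier K"
  shows "p ` (mlie_center K #>\<^bsub>K\<^esub> k) = mlie_center G #>\<^bsub>G\<^esub> p k"
proof
  have sub: "mlie_center K #>\<^bsub>K\<^esub> k \<subseteq> carrier K"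
    using assms dom.mlie_center_subgroup by (simp add: dom.r_coset_subset_G subgroup.subset)
  show "p ` (mlie_center K #>\<^bsub>K\<^esub> k) \<subseteq> mlie_center G #>\<^bsub>G\<^esub> p k"
    using sub assms mlie_center_rcos_iff by blast
  show "mlie_center G #>\<^bsub>G\<^esub> p k \<subseteq> p ` (mlie_center K #>\<^bsub>K\<^esub> k)"
  proof
    fix x assume x: "x \<in> mlie_center G #>\<^bsub>G\<^esub> p k"
    then have "x \<in> carrier G"
      using assms cod.mlie_center_subgroup subgroup.elemrcos_carrier cod.is_group hom_closed by metis
    then obtain l where "l \<in> carrier K" "x = p l" using surj by auto
    then show "x \<in> p ` (mlie_center K #>\<^bsub>K\<^esub> k)"
      using x assms mlie_center_rcos_iff by auto
  qed
qed

lemma carrier_mlie_quotient: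
  "carrier (mlie_quotient G (mlie_center G)) = {mlie_center G #>\<^bsub>G\<^esub> p k |k. k \<in> carrier K}"
  by (auto simp: mlie_quotient_def RCOSETS_def simp flip: surj)

end

text \<open>The central quotients of \<open>G\<close> and \<open>H\<close> are both identified with
  that of \<open>K\<close>, and so are the multiplicative commutators. Passing through
  \<open>K\<close> replaces symmetry and transitivity of isoclinism.\<close>

lemma isoclinic_span:
  assumes "isoclinic_epi K G p" "isoclinic_epi K H q"
  shows "isoclinic G H"
proof -
  interpret p: isoclinic_epi K G p by fact
  interpret q: isoclinic_epi K H q by fact
  let ?ZG = "mlie_center G" and ?ZH = "mlie_center H"
  let ?QG = "mlie_quotient G ?ZG" and ?QH = "mlie_quotient H ?ZH"
  \<comment> \<open>A coset is pulled back along \<open>p\<close> and pushed forward along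
    \<open>q\<close>, so no representatives are chosen.\<close>
  define f where "f A = q ` {k \<in> carrier K. p k \<in> A}" for A
  have f: "f (?ZG #>\<^bsub>G\<^esub> p k) = ?ZH #>\<^bsub>H\<^esub> q k" if k: "k \<in> carrier K" for k
  proof -
    have "{l \<in> carrier K. p l \<in> ?ZG #>\<^bsub>G\<^esub> p k} = mlie_center K #>\<^bsub>K\<^esub> k"
    proof -
      have "mlie_center K #>\<^bsub>K\<^esub> k \<subseteq> carrier K"
        using k by (simp add: p.dom.mlie_center_subgroup p.dom.r_coset_subset_G subgroup.subset)
      then show ?thesis
        using k p.mlie_center_rcos_iff by blast
    qed
    then show ?thesis
      unfolding f_def using q.image_mlie_center_rcos[OF k] by simp
  qed
  have rcos_mult: "(?ZG #>\<^bsub>G\<^esub> p k) \<otimes>\<^bsub>?QG\<^esub> (?ZG #>\<^bsub>G\<^esub> p l) = ?ZG #>\<^bsub>G\<^esub> p (k \<otimes>\<^bsub>K\<^esub> l)"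
    "(?ZH #>\<^bsub>H\<^esub> q k) \<otimes>\<^bsub>?QH\<^esub> (?ZH #>\<^bsub>H\<^esub> q l) = ?ZH #>\<^bsub>H\<^esub> q (k \<otimes>\<^bsub>K\<^esub> l)"
    if "k \<in> carrier K" "l \<in> carrier K" for k l
    using that normal.rcos_sum[OF p.cod.mlie_center_normal] normal.rcos_sum[OF q.cod.mlie_center_normal]
    by (simp_all add: mlie_quotient_def)
  have rcos_lstar: "(?ZG #>\<^bsub>G\<^esub> p k) \<star>\<^bsub>?QG\<^esub> (?ZG #>\<^bsub>G\<^esub> p l) = ?ZG #>\<^bsub>G\<^esub> p (k \<star>\<^bsub>K\<^esub> l)"
    "(?ZH #>\<^bsub>H\<^esub> q k) \<star>\<^bsub>?QH\<^esub> (?ZH #>\<^bsub>H\<^esub> q l) = ?ZH #>\<^bsub>H\<^esub> q (k \<star>\<^bsub>K\<^esub> l)"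
    if "k \<in> carrier K" "l \<in> carrier K" for k l
    using that by (simp_all add: p.cod.mlie_quotient_lstar q.cod.mlie_quotient_lstar p.p_lstar q.p_lstar)
  have "f \<in> hom ?QG ?QH"
    by (rule homI) (auto simp: p.carrier_mlie_quotient q.carrier_mlie_quotient f rcos_mult
        simp del: p.hom_mult q.hom_mult)
  moreover have "inj_on f (carrier ?QG)"
    unfolding p.carrier_mlie_quotient
    by (rule inj_onI, elim CollectE exE conjE)
       (simp add: f p.mlie_center_rcos_eq_iff q.mlie_center_rcos_eq_iff)
  moreover have "f ` carrier ?QG = carrier ?QH"
  proof -
    have "f ` carrier ?QG = (\<lambda>k. f (?ZG #>\<^bsub>G\<^esub> p k)) ` carrier K"
      unfolding p.carrier_mlie_quotient by blast
    also have "\<dots> = (\<lambda>k. ?ZH #>\<^bsub>H\<^esub> q k) ` carrier K"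
      by (rule image_cong) (simp_all add: f)
    finally show ?thesis
      unfolding q.carrier_mlie_quotient by blast
  qed
  moreover have "f (A \<star>\<^bsub>?QG\<^esub> B) = f A \<star>\<^bsub>?QH\<^esub> f B" if "A \<in> carrier ?QG" "B \<in> carrier ?QG" for A B
    using that unfolding p.carrier_mlie_quotient
    by (elim CollectE exE conjE) (simp add: f rcos_lstar)
  ultimately have f_iso: "f \<in> mlie_iso ?QG ?QH"
    by (simp add: mlie_iso_def iso_def bij_betw_def)

  interpret M: subgroup "mlie_commutator K" K by (rule p.dom.mlie_commutator_subgroup)
  \<comment> \<open>The inverse exists because \<open>p\<close> is injective on
    \<open>mlie_commutator K\<close>.\<close>
  define \<mu> where "\<mu> = q \<circ> inv_into (mlie_commutator K) p"
  have \<mu>: "\<mu> (p m) = q m" if "m \<in> mlie_commutator K" for m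
    using that p.inj_on_mlie_commutator by (simp add: \<mu>_def)
  have Mstar: "m \<star>\<^bsub>K\<^esub> n \<in> mlie_commutator K" if "m \<in> mlie_commutator K" "n \<in> mlie_commutator K" for m n
    using that by (simp add: p.dom.lstar_in_mlie_commutator)
  let ?MG = "G\<lparr>carrier := mlie_commutator G\<rparr>" and ?MH = "H\<lparr>carrier := mlie_commutator H\<rparr>"
  have "\<mu> \<in> hom ?MG ?MH"
    by (rule homI)
       (auto simp: \<mu> simp flip: p.image_mlie_commutator q.image_mlie_commutator p.hom_mult)
  moreover have "inj_on \<mu> (carrier ?MG)"
    unfolding \<mu>_def
    by (intro comp_inj_on inj_on_inv_into inj_on_subset[OF q.inj_on_mlie_commutator])
       (auto simp flip: p.image_mlie_commutator intro: inv_into_into)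
  moreover have "\<mu> ` carrier ?MG = carrier ?MH"
  proof -
    have "\<mu> ` p ` mlie_commutator K = q ` mlie_commutator K"
      by (simp add: image_image \<mu>)
    then show ?thesis
      by (simp add: p.image_mlie_commutator q.image_mlie_commutator)
  qed
  moreover have "\<mu> (x \<star>\<^bsub>?MG\<^esub> y) = \<mu> x \<star>\<^bsub>?MH\<^esub> \<mu> y" if "x \<in> carrier ?MG" "y \<in> carrier ?MG" for x y
  proof -
    have "x \<in> p ` mlie_commutator K" "y \<in> p ` mlie_commutator K"
      using that by (simp_all add: p.image_mlie_commutator)
    then obtain m n where "m \<in> mlie_commutator K" "x = p m" "n \<in> mlie_commutator K" "y = p n"
      by blast
    then show ?thesis
      using \<mu>[OF Mstar[of m n]] by (simp add: \<mu> p.p_lstar q.p_lstar)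
  qed
  ultimately have \<mu>_iso: "\<mu> \<in> mlie_iso ?MG ?MH"
    by (simp add: mlie_iso_def iso_def bij_betw_def)

  have "\<mu> (commutator G a b) = commutator H a' b' \<and> \<mu> (a \<star>\<^bsub>G\<^esub> b) = a' \<star>\<^bsub>H\<^esub> b'"
    if ab: "a \<in> carrier G" "b \<in> carrier G" "a' \<in> carrier H" "b' \<in> carrier H"
      and fa: "f (?ZG #>\<^bsub>G\<^esub> a) = ?ZH #>\<^bsub>H\<^esub> a'" and fb: "f (?ZG #>\<^bsub>G\<^esub> b) = ?ZH #>\<^bsub>H\<^esub> b'" for a b a' b'
  proof -
    obtain k l where k: "k \<in> carrier K" "a = p k" and l: "l \<in> carrier K" "b = p l"
      using ab p.surj by blast
    \<comment> \<open>The assumptions fix \<open>a'\<close> and \<open>b'\<close> only up to factors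
      from the center, which neither commutators nor stars detect.\<close>
    have "a' \<in> ?ZH #>\<^bsub>H\<^esub> q k" "b' \<in> ?ZH #>\<^bsub>H\<^esub> q l"
      using fa fb f k l ab q.cod.rcos_self q.cod.mlie_center_subgroup by auto
    then obtain c d where "c \<in> ?ZH" "a' = c \<otimes>\<^bsub>H\<^esub> q k" "d \<in> ?ZH" "b' = d \<otimes>\<^bsub>H\<^esub> q l"
      by (auto simp: r_coset_def)
    then have "commutator H a' b' = q (commutator K k l)" "a' \<star>\<^bsub>H\<^esub> b' = q (k \<star>\<^bsub>K\<^esub> l)"
      using k l by (simp_all add: q.cod.commutator_center_mult q.cod.lstar_center_mult q.p_commutator q.p_lstar)
    then show ?thesis
      using k l \<mu> by (simp add: p.dom.commutator_in_mlie_commutator p.dom.lstar_in_mlie_commutator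
          flip: p.p_commutator p.p_lstar)
  qed
  then show ?thesis
    unfolding isoclinic_def using f_iso \<mu>_iso by blast
qed

subsection \<open>Homomorphisms into free abelian groups\<close>

text \<open>A homomorphism into a free abelian group splits over its image. Instead of well-ordering a
  basis, Zorn's lemma is applied to subgroups \<open>C\<close> that meet the kernel trivially and whose image
  consists of all values of \<open>\<phi>\<close> supported on the basis elements occurring in \<open>\<phi> ` C\<close>.\<close>

lemma (in comm_group) hom_free_Abelian_group_complement:
  assumes \<phi>: "\<phi> \<in> hom G (free_Abelian_group S)"
  obtains C where "subgroup C G" "\<And>c. \<lbrakk>c \<in> C; \<phi> c = 0\<rbrakk> \<Longrightarrow> c = \<one>" "\<phi> ` C = \<phi> ` carrier G"
proof -
  interpret F: group_hom G "free_Abelian_group S" \<phi>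
    using \<phi> by (simp add: group_hom_def group_hom_axioms_def is_group)
  have add: "\<phi> (x \<otimes> y) = \<phi> x + \<phi> y" if "x \<in> carrier G" "y \<in> carrier G" for x y
    using F.hom_mult[OF that] by simp
  have pow: "\<phi> (x [^] k) = frag_cmul k (\<phi> x)" if "x \<in> carrier G" for x and k :: int
    using F.hom_int_pow[OF that, of k] F.hom_closed[OF that] by simp
  define supp where "supp C = (\<Union>c\<in>C. Poly_Mapping.keys (\<phi> c))" for C
  define \<A> where "\<A> = {C. subgroup C G \<and> (\<forall>c\<in>C. \<phi> c = 0 \<longrightarrow> c = \<one>) \<and>
    (\<forall>a\<in>carrier G. Poly_Mapping.keys (\<phi> a) \<subseteq> supp C \<longrightarrow> \<phi> a \<in> \<phi> ` C)}"
  have "\<exists>M\<in>\<A>. \<forall>Y\<in>\<A>. M \<subseteq> Y \<longrightarrow> Y = M"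
  proof (rule subset_Zorn_nonempty)
    have "\<phi> \<one> = 0" using F.hom_one by simp
    then have "{\<one>} \<in> \<A>"
      by (simp add: \<A>_def supp_def triv_subgroup)
    then show "\<A> \<noteq> {}" by blast
  next
    fix \<C> assume ne: "\<C> \<noteq> {}" and chain: "subset.chain \<A> \<C>"
    have sub: "\<C> \<subseteq> \<A>" and lin: "\<And>Y W. \<lbrakk>Y \<in> \<C>; W \<in> \<C>\<rbrakk> \<Longrightarrow> Y \<subseteq> W \<or> W \<subseteq> Y"
      using chain by (auto simp: subset.chain_def)
    have sg: "subgroup Y G" if "Y \<in> \<C>" for Y
      using that sub by (auto simp: \<A>_def)
    have "subgroup (\<Union>\<C>) G"
    proof (rule subgroupI)
      show "\<Union>\<C> \<subseteq> carrier G" using sg subgroup.subset by blast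
      show "\<Union>\<C> \<noteq> {}" using ne sg subgroup.one_closed by blast
      show "inv a \<in> \<Union>\<C>" if "a \<in> \<Union>\<C>" for a
        using that subgroup.m_inv_closed[OF sg] by blast
      show "a \<otimes> b \<in> \<Union>\<C>" if ab: "a \<in> \<Union>\<C>" "b \<in> \<Union>\<C>" for a b
      proof -
        obtain Y where "Y \<in> \<C>" "a \<in> Y" "b \<in> Y"
          using ab lin by blast
        then show ?thesis using subgroup.m_closed[OF sg] by blast
      qed
    qed
    moreover have "\<forall>c\<in>\<Union>\<C>. \<phi> c = 0 \<longrightarrow> c = \<one>"
      using sub by (auto simp: \<A>_def)
    moreover have "\<phi> a \<in> \<phi> ` \<Union>\<C>"
      if a: "a \<in> carrier G" and keys: "Poly_Mapping.keys (\<phi> a) \<subseteq> supp (\<Union>\<C>)" for a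
    proof -
      \<comment> \<open>A value has only finitely many keys, so elements of the union that witness
        them all lie in a single member \<open>Y\<close> of the chain.\<close>
      have "\<forall>k\<in>Poly_Mapping.keys (\<phi> a). \<exists>x. x \<in> \<Union>\<C> \<and> k \<in> Poly_Mapping.keys (\<phi> x)"
        using keys unfolding supp_def by blast
      then obtain g where g: "\<And>k. k \<in> Poly_Mapping.keys (\<phi> a) \<Longrightarrow>
          g k \<in> \<Union>\<C> \<and> k \<in> Poly_Mapping.keys (\<phi> (g k))"
        by metis
      have "finite (g ` Poly_Mapping.keys (\<phi> a))" by simp
      moreover have "g ` Poly_Mapping.keys (\<phi> a) \<subseteq> \<Union>\<C>" using g by blast
      ultimately obtain Y where Y: "Y \<in> \<C>" "g ` Poly_Mapping.keys (\<phi> a) \<subseteq> Y"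
        using finite_subset_Union_chain ne chain by metis
      then have "Poly_Mapping.keys (\<phi> a) \<subseteq> supp Y"
        using g by (auto simp: supp_def)
      then have "\<phi> a \<in> \<phi> ` Y"
        using Y sub a by (auto simp: \<A>_def)
      then show ?thesis using Y by blast
    qed
    ultimately show "\<Union>\<C> \<in> \<A>"
      by (simp add: \<A>_def)
  qed
  then obtain M where M: "M \<in> \<A>" and max: "\<And>Y. \<lbrakk>Y \<in> \<A>; M \<subseteq> Y\<rbrakk> \<Longrightarrow> Y = M"
    by blast
  interpret M: subgroup M G using M by (simp add: \<A>_def)
  have M_ker: "c = \<one>" if "c \<in> M" "\<phi> c = 0" for c
    using M that by (simp add: \<A>_def)
  have M_full: "\<phi> a \<in> \<phi> ` M" if "a \<in> carrier G" "Poly_Mapping.keys (\<phi> a) \<subseteq> supp M" for a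
    using M that by (simp add: \<A>_def)
  have "\<phi> a \<in> \<phi> ` M" if a: "a \<in> carrier G" for a
  proof (rule ccontr)
    assume "\<phi> a \<notin> \<phi> ` M"
    txt \<open>Choosing \<open>a1\<close> with as few new basis elements as possible forces values supported on
      \<open>supp M \<union> T\<close> to lie in \<open>\<phi> ` M\<close> as soon as their coefficient at \<open>s\<close> vanishes.\<close>
    define d where "d a = card (Poly_Mapping.keys (\<phi> a) - supp M)" for a
    obtain a1 where a1: "a1 \<in> carrier G" "\<phi> a1 \<notin> \<phi> ` M"
      and a1_min: "\<And>x. \<lbrakk>x \<in> carrier G; \<phi> x \<notin> \<phi> ` M\<rbrakk> \<Longrightarrow> d a1 \<le> d x"
      using ex_has_least_nat[of "\<lambda>x. x \<in> carrier G \<and> \<phi> x \<notin> \<phi> ` M" a d] a \<open>\<phi> a \<notin> \<phi> ` M\<close> by blast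
    define T where "T = Poly_Mapping.keys (\<phi> a1) - supp M"
    have "T \<noteq> {}" using M_full a1 by (auto simp: T_def)
    then obtain s where s: "s \<in> T" by blast
    then have s_notin: "s \<notin> supp M" by (simp add: T_def)
    define V where "V = {x \<in> carrier G. Poly_Mapping.keys (\<phi> x) \<subseteq> supp M \<union> T}"
    have V0: "\<phi> x \<in> \<phi> ` M" if x: "x \<in> V" "Poly_Mapping.lookup (\<phi> x) s = 0" for x
    proof (rule ccontr)
      assume "\<phi> x \<notin> \<phi> ` M"
      then have "card T \<le> d x" using a1_min[of x] x by (simp add: d_def T_def V_def)
      moreover have "Poly_Mapping.keys (\<phi> x) - supp M \<subseteq> T - {s}"
        using x by (auto simp: V_def in_keys_iff)
      then have "d x \<le> card (T - {s})"
        unfolding d_def by (intro card_mono) (simp_all add: T_def)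
      moreover have "card (T - {s}) < card T"
        using s by (intro psubset_card_mono) (auto simp: T_def)
      ultimately show False by simp
    qed
    have "a1 \<in> V \<and> Poly_Mapping.lookup (\<phi> a1) s \<noteq> 0"
      using a1 s by (auto simp: V_def T_def in_keys_iff)
    \<comment> \<open>The coefficients at \<open>s\<close> of values on \<open>V\<close> form a
      subgroup of the integers; a nonzero one of least absolute value generates it.\<close>
    then obtain b where b: "b \<in> V" "Poly_Mapping.lookup (\<phi> b) s \<noteq> 0"
      and b_min: "\<And>x. \<lbrakk>x \<in> V; Poly_Mapping.lookup (\<phi> x) s \<noteq> 0\<rbrakk> \<Longrightarrow>
        nat \<bar>Poly_Mapping.lookup (\<phi> b) s\<bar> \<le> nat \<bar>Poly_Mapping.lookup (\<phi> x) s\<bar>"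
      using ex_has_least_nat[of "\<lambda>x. x \<in> V \<and> Poly_Mapping.lookup (\<phi> x) s \<noteq> 0" a1
          "\<lambda>x. nat \<bar>Poly_Mapping.lookup (\<phi> x) s\<bar>"] by blast
    define n where "n = Poly_Mapping.lookup (\<phi> b) s"
    have bG: "b \<in> carrier G" using b by (simp add: V_def)
    have M_V: "m \<in> V" if "m \<in> M" for m
      using that by (auto simp: V_def supp_def)
    have V_mult: "x \<otimes> b [^] k \<in> V" if "x \<in> V" for x and k :: int
    proof -
      have "Poly_Mapping.keys (\<phi> x + frag_cmul k (\<phi> b)) \<subseteq> supp M \<union> T"
        using that b keys_add[of "\<phi> x" "frag_cmul k (\<phi> b)"] keys_cmul[of k "\<phi> b"]
        unfolding V_def by blast
      then show ?thesis
        using that bG by (simp add: V_def add pow)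
    qed
    have V_full: "\<exists>m\<in>M. \<exists>k::int. \<phi> x = \<phi> (m \<otimes> b [^] k)" if x: "x \<in> V" for x
    proof -
      \<comment> \<open>Division with remainder: multiplying by \<open>b [^] (- k)\<close> leaves
        the remainder modulo \<open>n\<close> as coefficient at \<open>s\<close>. Minimality of
        \<open>b\<close> forces it to be zero, so \<open>V0\<close> applies.\<close>
      define k where "k = Poly_Mapping.lookup (\<phi> x) s div n"
      have xG: "x \<in> carrier G" using x by (simp add: V_def)
      have l: "Poly_Mapping.lookup (\<phi> (x \<otimes> b [^] (- k))) s = Poly_Mapping.lookup (\<phi> x) s mod n"
        using xG bG by (simp add: add pow lookup_add k_def n_def minus_div_mult_eq_mod)
      have "Poly_Mapping.lookup (\<phi> (x \<otimes> b [^] (- k))) s = 0"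
      proof (rule ccontr)
        assume "Poly_Mapping.lookup (\<phi> (x \<otimes> b [^] (- k))) s \<noteq> 0"
        then have "\<bar>n\<bar> \<le> \<bar>Poly_Mapping.lookup (\<phi> x) s mod n\<bar>"
          using b_min[OF V_mult[OF x, of "- k"]] l by (simp add: n_def)
        then show False
          using b abs_mod_less[of n "Poly_Mapping.lookup (\<phi> x) s"] by (simp add: n_def)
      qed
      then obtain m where m: "m \<in> M" "\<phi> (x \<otimes> b [^] (- k)) = \<phi> m"
        using V0[OF V_mult[OF x]] by blast
      have "\<phi> x = (\<phi> x + frag_cmul (- k) (\<phi> b)) + frag_cmul k (\<phi> b)"
        by (simp add: add.assoc flip: frag_cmul_distrib)
      also have "\<phi> x + frag_cmul (- k) (\<phi> b) = \<phi> m"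
        using m xG bG by (simp add: add pow)
      finally have "\<phi> x = \<phi> (m \<otimes> b [^] k)"
        using m bG by (simp add: add pow)
      then show ?thesis using m by blast
    qed
    \<comment> \<open>Adjoining \<open>b\<close> to \<open>M\<close> gives a strictly larger member
      of \<open>\<A>\<close>, against maximality.\<close>
    define C where "C = M <#> generate G {b}"
    have C: "C = {m \<otimes> b [^] k |m k. m \<in> M \<and> k \<in> (UNIV :: int set)}"
      by (auto simp: C_def set_mult_def generate_pow[OF bG])
    have "subgroup C G"
      unfolding C_def using bG
      by (intro mult_norm_subgroup generate_is_subgroup) (auto intro: subgroup_imp_normal M.subgroup_axioms)
    moreover have "\<forall>c\<in>C. \<phi> c = 0 \<longrightarrow> c = \<one>"
    proof (intro ballI impI)
      fix c assume "c \<in> C" and c0: "\<phi> c = 0"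
      then obtain m and k :: int where c: "m \<in> M" "c = m \<otimes> b [^] k"
        by (auto simp: C)
      \<comment> \<open>Values on \<open>M\<close> have no coefficient at \<open>s\<close>, so that
        of \<open>\<phi> c\<close> is \<open>k * n\<close>, where
        \<open>n \<noteq> 0\<close>.\<close>
      have "Poly_Mapping.lookup (\<phi> m) s = 0"
        using s_notin c by (auto simp: supp_def in_keys_iff)
      moreover have "\<phi> m + frag_cmul k (\<phi> b) = 0"
        using c0 c bG by (simp add: add pow)
      then have "Poly_Mapping.lookup (\<phi> m) s + k * n = 0"
        by (metis lookup_add lookup_frag_cmul lookup_zero n_def)
      ultimately have "k = 0" using b by (simp add: n_def)
      then show "c = \<one>"
        using c c0 M_ker by simp
    qed
    moreover have "\<phi> x \<in> \<phi> ` C"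
      if "x \<in> carrier G" "Poly_Mapping.keys (\<phi> x) \<subseteq> supp C" for x
    proof -
      \<comment> \<open>The new basis elements all come from \<open>T\<close>, so
        \<open>V_full\<close> covers every value supported on \<open>supp C\<close>.\<close>
      have "supp C \<subseteq> supp M \<union> T"
        using V_mult[OF M_V] by (auto simp: supp_def C V_def)
      then have "x \<in> V" using that by (auto simp: V_def)
      then obtain m and k :: int where m: "m \<in> M" "\<phi> x = \<phi> (m \<otimes> b [^] k)"
        using V_full by blast
      then have "m \<otimes> b [^] k \<in> C" unfolding C by blast
      then show ?thesis using m(2) by (rule rev_image_eqI)
    qed
    ultimately have "C \<in> \<A>" by (simp add: \<A>_def)
    moreover have "M \<subseteq> C"
    proof
      fix m assume "m \<in> M"
      then have "m = m \<otimes> b [^] (0::int)" by simp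
      then show "m \<in> C" using \<open>m \<in> M\<close> unfolding C by blast
    qed
    ultimately have "C = M" by (rule max)
    moreover have "b = \<one> \<otimes> b [^] (1::int)" using bG by simp
    then have "b \<in> C" unfolding C using M.one_closed by blast
    ultimately have "b \<in> M" by simp
    \<comment> \<open>The coefficient of \<open>\<phi> b\<close> at \<open>s\<close> is nonzero, so
      \<open>b \<in> M\<close> puts \<open>s\<close> into \<open>supp M\<close>.\<close>
    then show False
      using b s_notin by (auto simp: supp_def in_keys_iff)
  qed
  then have "\<phi> ` M = \<phi> ` carrier G"
    using M.subset by blast
  then show ?thesis
    using that M.subgroup_axioms M_ker by blast
qed

subsection \<open>Central quotients\<close>

text \<open>The axioms are identities and pass to surjective images. The group structure of
  \<open>H\<close> comes first, since it makes \<open>q\<close> a group homomorphism and hence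
  compatible with inverses and conjugation.\<close>

lemma mult_lie_algebra_image:
  assumes "mult_lie_algebra K"
    and carrier: "carrier H = q ` carrier K" and one: "q \<one>\<^bsub>K\<^esub> = \<one>\<^bsub>H\<^esub>"
    and mult: "\<And>x y. \<lbrakk>x \<in> carrier K; y \<in> carrier K\<rbrakk> \<Longrightarrow> q (x \<otimes>\<^bsub>K\<^esub> y) = q x \<otimes>\<^bsub>H\<^esub> q y"
    and lstar: "\<And>x y. \<lbrakk>x \<in> carrier K; y \<in> carrier K\<rbrakk> \<Longrightarrow> q (x \<star>\<^bsub>K\<^esub> y) = q x \<star>\<^bsub>H\<^esub> q y"
  shows "mult_lie_algebra H"
proof -
  interpret K: mult_lie_algebra K by fact
  have "group H"
  proof (rule groupI)
    show "\<exists>y\<in>carrier H. y \<otimes>\<^bsub>H\<^esub> x = \<one>\<^bsub>H\<^esub>" if x: "x \<in> carrier H" for x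
    proof -
      obtain a where a: "a \<in> carrier K" "x = q a" using x carrier by auto
      then have "q (inv\<^bsub>K\<^esub> a) \<otimes>\<^bsub>H\<^esub> x = \<one>\<^bsub>H\<^esub>"
        by (simp flip: mult one)
      then show ?thesis using a carrier by blast
    qed
  qed (auto simp: carrier K.m_assoc simp flip: mult one)
  then interpret H: group H .
  interpret q: group_hom K H q
    by unfold_locales (auto simp: hom_def carrier mult)
  have lconj: "lconj H (q x) (q y) = q (lconj K x y)" if "x \<in> carrier K" "y \<in> carrier K" for x y
    using that by (simp add: lconj_def mult)
  have cases: "thesis" if "x \<in> carrier H" "\<And>a. \<lbrakk>a \<in> carrier K; x = q a\<rbrakk> \<Longrightarrow> thesis" for x thesis
    using that carrier by blast
  show ?thesis
  proof
    fix x y z assume "x \<in> carrier H" "y \<in> carrier H" "z \<in> carrier H"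
    then obtain a b c where [simp]: "a \<in> carrier K" "x = q a" "b \<in> carrier K" "y = q b"
        "c \<in> carrier K" "z = q c"
      using cases by metis
    note flip = lconj lstar[symmetric] mult[symmetric] one[symmetric]
    show "x \<star>\<^bsub>H\<^esub> (y \<otimes>\<^bsub>H\<^esub> z) = x \<star>\<^bsub>H\<^esub> y \<otimes>\<^bsub>H\<^esub> lconj H y (x \<star>\<^bsub>H\<^esub> z)"
      by (simp add: flip K.lstar_mult_right del: q.hom_mult)
    show "x \<otimes>\<^bsub>H\<^esub> y \<star>\<^bsub>H\<^esub> z = lconj H x (y \<star>\<^bsub>H\<^esub> z) \<otimes>\<^bsub>H\<^esub> (x \<star>\<^bsub>H\<^esub> z)"
      by (simp add: flip K.lstar_mult_left del: q.hom_mult)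
    show "(x \<star>\<^bsub>H\<^esub> y) \<star>\<^bsub>H\<^esub> lconj H y z \<otimes>\<^bsub>H\<^esub> ((y \<star>\<^bsub>H\<^esub> z) \<star>\<^bsub>H\<^esub> lconj H z x) \<otimes>\<^bsub>H\<^esub>
        ((z \<star>\<^bsub>H\<^esub> x) \<star>\<^bsub>H\<^esub> lconj H x y) = \<one>\<^bsub>H\<^esub>"
    proof -
      have "\<one>\<^bsub>H\<^esub> = q ((a \<star>\<^bsub>K\<^esub> b) \<star>\<^bsub>K\<^esub> lconj K b c \<otimes>\<^bsub>K\<^esub> ((b \<star>\<^bsub>K\<^esub> c) \<star>\<^bsub>K\<^esub> lconj K c a) \<otimes>\<^bsub>K\<^esub>
          ((c \<star>\<^bsub>K\<^esub> a) \<star>\<^bsub>K\<^esub> lconj K a b))"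
        by (simp only: K.lstar_jacobi one \<open>a \<in> carrier K\<close> \<open>b \<in> carrier K\<close> \<open>c \<in> carrier K\<close>)
      then show ?thesis
        by (simp add: lstar flip: lconj)
    qed
    show "lconj H z (x \<star>\<^bsub>H\<^esub> y) = lconj H z x \<star>\<^bsub>H\<^esub> lconj H z y"
      by (simp add: flip K.lconj_lstar)
    show "x \<star>\<^bsub>H\<^esub> y \<in> carrier H"
      by (simp add: flip)
    show "x \<star>\<^bsub>H\<^esub> x = \<one>\<^bsub>H\<^esub>"
      by (simp add: K.lstar_self flip: lstar)
  qed
qed

text \<open>The quotient by \<open>C\<close> is realized on labels: any \<open>q\<close> whose
  fibres are the cosets of \<open>C\<close> serves as the projection, which leaves the element type
  of the quotient free.\<close>

lemma (in mult_lie_algebra) central_quotient_realization: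
  fixes q :: "'a \<Rightarrow> 'b"
  assumes C: "subgroup C G" "C \<subseteq> mlie_center G"
    and trivial: "\<And>c. \<lbrakk>c \<in> C; c \<in> mlie_commutator G\<rbrakk> \<Longrightarrow> c = \<one>"
    and q: "\<And>x y. \<lbrakk>x \<in> carrier G; y \<in> carrier G\<rbrakk> \<Longrightarrow> q x = q y \<longleftrightarrow> C #> x = C #> y"
  obtains H :: "'b mult_lie" where "isoclinic_epi G H q"
proof -
  interpret C: subgroup C G by fact
  have "C \<lhd> G"
  proof (rule normal_invI[OF C(1)])
    fix x c assume "x \<in> carrier G" "c \<in> C"
    moreover from this have "x \<otimes> c \<otimes> inv x = c"
      using C(2) by (metis C.mem_carrier inv_solve_right' m_closed mlie_center_comm subsetD)
    ultimately show "x \<otimes> c \<otimes> inv x \<in> C" by simp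
  qed
  \<comment> \<open>A section of \<open>q\<close>: operations on labels are computed on
    representatives, and \<open>j_rcos\<close> makes their choice immaterial.\<close>
  define j where "j = inv_into (carrier G) q"
  have j: "j (q x) \<in> carrier G" "q (j (q x)) = q x" if "x \<in> carrier G" for x
    using that by (auto simp: j_def inv_into_into f_inv_into_f)
  have j_rcos: "C #> j (q x) = C #> x" if "x \<in> carrier G" for x
    using j[OF that] q that by blast
  define H where "H = \<lparr>carrier = q ` carrier G, monoid.mult = (\<lambda>u v. q (j u \<otimes> j v)), one = q \<one>,
    lstar = (\<lambda>u v. q (j u \<star> j v))\<rparr>"
  have mult: "q (x \<otimes> y) = q x \<otimes>\<^bsub>H\<^esub> q y" if xy: "x \<in> carrier G" "y \<in> carrier G" for x y
  proof -
    have "C #> (x \<otimes> y) = C #> (j (q x) \<otimes> j (q y))"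
      using xy j j_rcos by (simp flip: normal.rcos_sum[OF \<open>C \<lhd> G\<close>])
    then show ?thesis
      using xy j q by (simp add: H_def)
  qed
  have lstar: "q (x \<star> y) = q x \<star>\<^bsub>H\<^esub> q y" if xy: "x \<in> carrier G" "y \<in> carrier G" for x y
  proof -
    \<comment> \<open>Representatives differ by central elements, so the stars themselves agree and
      not only their cosets.\<close>
    have "j (q x) \<in> C #> x" "j (q y) \<in> C #> y"
      using xy j j_rcos rcos_self[OF _ C(1)] by metis+
    then obtain c d where "c \<in> C" "j (q x) = c \<otimes> x" "d \<in> C" "j (q y) = d \<otimes> y"
      by (auto simp: r_coset_def)
    then have "j (q x) \<star> j (q y) = x \<star> y"
      using xy C(2) by (simp add: lstar_center_mult subset_iff)
    then show ?thesis by (simp add: H_def)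
  qed
  have "mult_lie_algebra H"
    by (rule mult_lie_algebra_image[OF mult_lie_algebra_axioms _ _ mult lstar]) (simp_all add: H_def)
  \<comment> \<open>The kernel of \<open>q\<close> is the coset of the identity, which is
    \<open>C\<close>.\<close>
  moreover have "x = \<one>" if "x \<in> mlie_commutator G" "q x = \<one>\<^bsub>H\<^esub>" for x
  proof -
    have x: "x \<in> carrier G"
      using that mlie_commutator_subgroup subgroup.mem_carrier by fast
    have "C #> x = C #> \<one>"
      using that x q by (simp add: H_def)
    then have "x \<in> C"
      using x coset_join1[OF _ x C(1)] C.subset by simp
    then show ?thesis using that trivial by blast
  qed
  ultimately have "isoclinic_epi G H q"
    using mult lstar mult_lie_algebra_axioms
    by (auto simp: isoclinic_epi_def isoclinic_epi_axioms_def hom_def H_def)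
  then show ?thesis by (rule that)
qed

text \<open>Labelling the cosets of \<open>C\<close> in \<open>K\<close> by elements of \<open>G\<close> itself is what keeps the stem
  algebra on the element type of \<open>G\<close>: modulo \<open>C\<close>, every element is \<open>w \<otimes> s\<close> with \<open>w \<in> N\<close> and \<open>s\<close>
  in a transversal of the center, and \<open>p\<close> is injective on such products.\<close>

lemma (in isoclinic_epi) central_coset_labelling:
  assumes C: "subgroup C K" "C \<subseteq> mlie_center K"
    and N: "N \<subseteq> mlie_center K" "inj_on p N"
    and CN: "\<And>z. z \<in> mlie_center K \<Longrightarrow> \<exists>w\<in>N. w \<in> C #>\<^bsub>K\<^esub> z"
  obtains q :: "'a \<Rightarrow> 'b" where
    "\<And>x y. \<lbrakk>x \<in> carrier K; y \<in> carrier K\<rbrakk> \<Longrightarrow> q x = q y \<longleftrightarrow> C #>\<^bsub>K\<^esub> x = C #>\<^bsub>K\<^esub> y"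
proof -
  let ?Z = "mlie_center K"
  interpret Z: subgroup ?Z K by (rule dom.mlie_center_subgroup)
  interpret C: subgroup C K by fact
  \<comment> \<open>The choice is made from a coset of the center as a set, so \<open>s\<close> is
    constant on that coset. Likewise \<open>w x\<close> depends only on the coset of
    \<open>C\<close> from which it is chosen.\<close>
  define s where "s x = (SOME y. y \<in> ?Z #>\<^bsub>K\<^esub> x)" for x
  define w where "w x = (SOME w. w \<in> N \<and> w \<in> C #>\<^bsub>K\<^esub> (x \<otimes>\<^bsub>K\<^esub> inv\<^bsub>K\<^esub> s x))" for x
  define q where "q x = p (w x \<otimes>\<^bsub>K\<^esub> s x)" for x
  have s: "s x \<in> ?Z #>\<^bsub>K\<^esub> x" if "x \<in> carrier K" for x
    unfolding s_def by (rule someI) (rule dom.rcos_self[OF that Z.subgroup_axioms])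
  have sK: "s x \<in> carrier K" if "x \<in> carrier K" for x
    using s[OF that] that by (rule Z.elemrcos_carrier[OF dom.is_group, rotated])
  have "x \<otimes>\<^bsub>K\<^esub> inv\<^bsub>K\<^esub> s x \<in> ?Z" if x: "x \<in> carrier K" for x
  proof -
    have "s x \<otimes>\<^bsub>K\<^esub> inv\<^bsub>K\<^esub> x \<in> ?Z"
      using s[OF x] x sK by (simp add: Z.rcos_module dom.is_group)
    then have "inv\<^bsub>K\<^esub> (s x \<otimes>\<^bsub>K\<^esub> inv\<^bsub>K\<^esub> x) \<in> ?Z" by simp
    then show ?thesis using x sK by (simp add: dom.inv_mult_group)
  qed
  then have w: "w x \<in> N" "w x \<in> C #>\<^bsub>K\<^esub> (x \<otimes>\<^bsub>K\<^esub> inv\<^bsub>K\<^esub> s x)" if "x \<in> carrier K" for x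
    using that CN[of "x \<otimes>\<^bsub>K\<^esub> inv\<^bsub>K\<^esub> s x"] someI_ex[of "\<lambda>w. w \<in> N \<and> w \<in> C #>\<^bsub>K\<^esub> (x \<otimes>\<^bsub>K\<^esub> inv\<^bsub>K\<^esub> s x)"]
    unfolding w_def by blast+
  have wZ: "w x \<in> ?Z" if "x \<in> carrier K" for x
    using w(1)[OF that] N by blast
  have Z_rcos: "?Z #>\<^bsub>K\<^esub> (w x \<otimes>\<^bsub>K\<^esub> s x) = ?Z #>\<^bsub>K\<^esub> x" if x: "x \<in> carrier K" for x
  proof -
    have "?Z #>\<^bsub>K\<^esub> (w x \<otimes>\<^bsub>K\<^esub> s x) = ?Z #>\<^bsub>K\<^esub> s x"
      using x sK wZ by (simp add: dom.coset_join2 Z.subgroup_axioms Z.subset flip: dom.coset_mult_assoc)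
    also have "\<dots> = ?Z #>\<^bsub>K\<^esub> x"
      using dom.repr_independence[OF s[OF x] x Z.subgroup_axioms] by simp
    finally show ?thesis .
  qed
  have C_rcos: "C #>\<^bsub>K\<^esub> (w x \<otimes>\<^bsub>K\<^esub> s x) = C #>\<^bsub>K\<^esub> x" if x: "x \<in> carrier K" for x
  proof -
    have "C #>\<^bsub>K\<^esub> (w x \<otimes>\<^bsub>K\<^esub> s x) = C #>\<^bsub>K\<^esub> w x #>\<^bsub>K\<^esub> s x"
      using x sK wZ by (simp add: dom.coset_mult_assoc C.subset)
    also have "C #>\<^bsub>K\<^esub> w x = C #>\<^bsub>K\<^esub> (x \<otimes>\<^bsub>K\<^esub> inv\<^bsub>K\<^esub> s x)"
      using w(2)[OF x] x sK by (intro dom.repr_independence[symmetric]) (auto intro: C.subgroup_axioms)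
    also have "\<dots> #>\<^bsub>K\<^esub> s x = C #>\<^bsub>K\<^esub> x"
      using x sK by (simp add: dom.coset_mult_assoc C.subset dom.m_assoc)
    finally show ?thesis .
  qed
  have "q x = q y \<longleftrightarrow> C #>\<^bsub>K\<^esub> x = C #>\<^bsub>K\<^esub> y" if x: "x \<in> carrier K" and y: "y \<in> carrier K" for x y
  proof
    assume qq: "q x = q y"
    \<comment> \<open>Factors from the center do not change its cosets, so equal labels put
      \<open>x\<close> and \<open>y\<close> in the same coset and \<open>s x = s y\<close>.
      Cancelling \<open>p (s x)\<close> leaves a question about \<open>p\<close> on
      \<open>N\<close>.\<close>
    have "?Z #>\<^bsub>K\<^esub> (w x \<otimes>\<^bsub>K\<^esub> s x) = ?Z #>\<^bsub>K\<^esub> (w y \<otimes>\<^bsub>K\<^esub> s y)"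
      using qq x y sK wZ by (subst mlie_center_rcos_eq_iff[symmetric]) (auto simp: q_def)
    then have "s x = s y"
      using Z_rcos x y by (simp add: s_def)
    then have "p (w x) = p (w y)"
      using qq x y sK wZ by (simp add: q_def)
    then have "w x = w y"
      using inj_onD[OF N(2)] w(1) x y by blast
    then show "C #>\<^bsub>K\<^esub> x = C #>\<^bsub>K\<^esub> y"
      using \<open>s x = s y\<close> C_rcos[OF x] C_rcos[OF y] by simp
  next
    assume eq: "C #>\<^bsub>K\<^esub> x = C #>\<^bsub>K\<^esub> y"
    then have "x \<in> C #>\<^bsub>K\<^esub> y"
      using dom.rcos_self[OF x C(1)] by simp
    then have "x \<in> ?Z #>\<^bsub>K\<^esub> y"
      using C(2) by (auto simp: r_coset_def)
    then have "?Z #>\<^bsub>K\<^esub> y = ?Z #>\<^bsub>K\<^esub> x"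
      using y by (intro dom.repr_independence Z.subgroup_axioms)
    then have ss: "s x = s y" by (simp add: s_def)
    \<comment> \<open>The choices defining \<open>w x\<close> and \<open>w y\<close> are therefore
      made from the same coset of \<open>C\<close>.\<close>
    have "C #>\<^bsub>K\<^esub> (x \<otimes>\<^bsub>K\<^esub> inv\<^bsub>K\<^esub> s y) = C #>\<^bsub>K\<^esub> (y \<otimes>\<^bsub>K\<^esub> inv\<^bsub>K\<^esub> s y)"
      using eq x y sK by (simp add: C.subset flip: dom.coset_mult_assoc)
    then show "q x = q y"
      using ss by (simp add: q_def w_def)
  qed
  then show ?thesis by (rule that)
qed

subsection \<open>The free cover\<close>

text \<open>All commutators are factored out. The universal property of free abelian groups asks for
  such a commutative target.\<close>

lemma (in mult_lie_algebra) mlie_abelianization_comm_group: "comm_group (G Mod mlie_commutator G)"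
proof (rule group.group_comm_groupI)
  interpret M: normal "mlie_commutator G" G by (rule mlie_commutator_normal)
  show "group (G Mod mlie_commutator G)" by (rule M.factorgroup_is_group)
  fix A B assume "A \<in> carrier (G Mod mlie_commutator G)" "B \<in> carrier (G Mod mlie_commutator G)"
  then obtain a b where ab: "a \<in> carrier G" "A = mlie_commutator G #> a"
      "b \<in> carrier G" "B = mlie_commutator G #> b"
    by (auto simp: carrier_FactGroup)
  have "inv b \<otimes> (b \<otimes> a) = a"
    using ab by (simp flip: m_assoc)
  then have "a \<otimes> b = commutator G a b \<otimes> (b \<otimes> a)"
    using ab by (simp add: commutator_def m_assoc)
  then have "a \<otimes> b \<in> mlie_commutator G #> (b \<otimes> a)"
    using ab commutator_in_mlie_commutator by (auto simp: r_coset_def)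
  then have "mlie_commutator G #> (b \<otimes> a) = mlie_commutator G #> (a \<otimes> b)"
    using ab by (intro repr_independence M.subgroup_axioms) auto
  then show "A \<otimes>\<^bsub>G Mod mlie_commutator G\<^esub> B = B \<otimes>\<^bsub>G Mod mlie_commutator G\<^esub> A"
    using ab by (simp add: M.rcos_sum)
qed

text \<open>\<open>h\<close> extends the projection of \<open>G\<close> onto its quotient from the
  basis to the free abelian group. With all elements of \<open>G\<close> as basis,
  \<open>(x, frag_of x)\<close> is a preimage of \<open>x\<close> under the first projection of the
  cover.\<close>

locale free_cover = mult_lie_algebra G for G :: "('a, 'm) mult_lie_scheme" (structure) +
  fixes h :: "('a \<Rightarrow>\<^sub>0 int) \<Rightarrow> 'a set"
  assumes h_hom: "h \<in> hom (free_Abelian_group (carrier G)) (G Mod mlie_commutator G)"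
    and h_frag_of: "x \<in> carrier G \<Longrightarrow> h (frag_of x) = mlie_commutator G #> x"
begin

text \<open>The condition on keys says that \<open>u\<close> lies in the free abelian group. The
  zero in the star is admissible because stars in \<open>G\<close> have trivial coset.\<close>

definition cover :: "('a \<times> ('a \<Rightarrow>\<^sub>0 int)) mult_lie" where
  "cover = \<lparr>carrier = {(x, u). x \<in> carrier G \<and> Poly_Mapping.keys u \<subseteq> carrier G \<and>
        h u = mlie_commutator G #> x},
     monoid.mult = (\<lambda>(x, u) (y, v). (x \<otimes> y, u + v)), one = (\<one>, 0),
     lstar = (\<lambda>(x, u) (y, v). (x \<star> y, 0))\<rparr>"

lemma carrier_cover_iff:
  "(x, u) \<in> carrier cover \<longleftrightarrow>
     x \<in> carrier G \<and> Poly_Mapping.keys u \<subseteq> carrier G \<and> h u = mlie_commutator G #> x"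
  by (simp add: cover_def)

lemma cover_simps [simp]:
  "(x, u) \<otimes>\<^bsub>cover\<^esub> (y, v) = (x \<otimes> y, u + v)"
  "(x, u) \<star>\<^bsub>cover\<^esub> (y, v) = (x \<star> y, 0)"
  "\<one>\<^bsub>cover\<^esub> = (\<one>, 0)"
  by (simp_all add: cover_def)

sublocale M: normal "mlie_commutator G" G
  by (rule mlie_commutator_normal)

sublocale h: group_hom "free_Abelian_group (carrier G)" "G Mod mlie_commutator G" h
  using h_hom M.factorgroup_is_group by (simp add: group_hom_def group_hom_axioms_def)

sublocale rcos: group_hom G "G Mod mlie_commutator G" "\<lambda>x. mlie_commutator G #> x"
  using M.factorgroup_is_group M.r_coset_hom_Mod
  by (simp add: group_hom_def group_hom_axioms_def is_group)

lemma h_zero: "h 0 = mlie_commutator G"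
  using h.hom_one by simp

text \<open>Membership of \<open>(x, 0)\<close> says that the coset of \<open>x\<close> is trivial.
  This admits the stars to the cover and describes the kernel of \<open>snd\<close>.\<close>

lemma carrier_cover_zero_iff: "(x, 0) \<in> carrier cover \<longleftrightarrow> x \<in> mlie_commutator G"
proof
  assume "(x, 0) \<in> carrier cover"
  then show "x \<in> mlie_commutator G"
    using coset_join1[of "mlie_commutator G" x] M.subset M.subgroup_axioms
    by (simp add: carrier_cover_iff h_zero)
next
  assume "x \<in> mlie_commutator G"
  then show "(x, 0) \<in> carrier cover"
    using M.subgroup_axioms by (simp add: carrier_cover_iff h_zero coset_join2)
qed

lemma cover_mult_closed:
  assumes "(x, u) \<in> carrier cover" "(y, v) \<in> carrier cover"
  shows "(x \<otimes> y, u + v) \<in> carrier cover"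
  using assms keys_add[of u v] h.hom_mult[of u v] rcos.hom_mult[of x y]
  by (auto simp: carrier_cover_iff)

lemma cover_inv_closed:
  assumes "(x, u) \<in> carrier cover"
  shows "(inv x, - u) \<in> carrier cover"
  using assms h.hom_inv[of u] rcos.hom_inv[of x] by (auto simp: carrier_cover_iff)

lemma group_cover: "group cover"
proof (rule groupI)
  show "x \<otimes>\<^bsub>cover\<^esub> y \<in> carrier cover" if "x \<in> carrier cover" "y \<in> carrier cover" for x y
    using that cover_mult_closed by (cases x; cases y) simp
  show "\<one>\<^bsub>cover\<^esub> \<in> carrier cover"
    by (simp add: carrier_cover_zero_iff)
  show "x \<otimes>\<^bsub>cover\<^esub> y \<otimes>\<^bsub>cover\<^esub> z = x \<otimes>\<^bsub>cover\<^esub> (y \<otimes>\<^bsub>cover\<^esub> z)"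
    if "x \<in> carrier cover" "y \<in> carrier cover" "z \<in> carrier cover" for x y z
    using that by (cases x; cases y; cases z) (simp add: carrier_cover_iff m_assoc add.assoc)
  show "\<one>\<^bsub>cover\<^esub> \<otimes>\<^bsub>cover\<^esub> x = x" if "x \<in> carrier cover" for x
    using that by (cases x) (simp add: carrier_cover_iff)
  show "\<exists>y\<in>carrier cover. y \<otimes>\<^bsub>cover\<^esub> x = \<one>\<^bsub>cover\<^esub>" if x: "x \<in> carrier cover" for x
  proof -
    obtain g u where "x = (g, u)" by (cases x)
    then show ?thesis
      using x cover_inv_closed[of g u] by (intro bexI[of _ "(inv g, - u)"]) (auto simp: carrier_cover_iff)
  qed
qed

text \<open>The second factor is abelian, so conjugation affects the first component only.\<close>

lemma lconj_cover:
  assumes "(x, u) \<in> carrier cover" "(y, v) \<in> carrier cover"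
  shows "lconj cover (x, u) (y, v) = (lconj G x y, v)"
proof -
  have "inv\<^bsub>cover\<^esub> (x, u) = (inv x, - u)"
    using assms(1) cover_inv_closed[OF assms(1)]
    by (intro group.inv_equality[OF group_cover]) (auto simp: carrier_cover_iff)
  then show ?thesis by (simp add: lconj_def)
qed

text \<open>In the star axioms the first components reproduce those of \<open>G\<close>, and the
  second ones are zero on both sides, since conjugation preserves a zero second component.\<close>

lemma mult_lie_algebra_cover: "mult_lie_algebra cover"
proof -
  interpret K: group cover by (rule group_cover)
  have star: "(x \<star> y, 0) \<in> carrier cover" if "x \<in> carrier G" "y \<in> carrier G" for x y
    using that by (simp add: carrier_cover_zero_iff lstar_in_mlie_commutator)
  have conj: "(lconj G x y, v) \<in> carrier cover"
    if "(x, u) \<in> carrier cover" "(y, v) \<in> carrier cover" for x y u v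
    using K.m_closed[OF K.m_closed[OF that] K.inv_closed[OF that(1)]] lconj_cover[OF that]
    by (simp add: lconj_def)
  have G: "x \<in> carrier G" if "(x, u) \<in> carrier cover" for x u
    using that by (simp add: carrier_cover_iff)
  show ?thesis
  proof
    fix x y z assume "x \<in> carrier cover" "y \<in> carrier cover" "z \<in> carrier cover"
    then obtain a u b v c w where xyz: "x = (a, u)" "(a, u) \<in> carrier cover"
        "y = (b, v)" "(b, v) \<in> carrier cover" "z = (c, w)" "(c, w) \<in> carrier cover"
      by (cases x; cases y; cases z) auto
    then have [simp]: "a \<in> carrier G" "b \<in> carrier G" "c \<in> carrier G"
      using G by auto
    show "x \<star>\<^bsub>cover\<^esub> (y \<otimes>\<^bsub>cover\<^esub> z) = x \<star>\<^bsub>cover\<^esub> y \<otimes>\<^bsub>cover\<^esub> lconj cover y (x \<star>\<^bsub>cover\<^esub> z)"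
      using xyz by (simp add: lstar_mult_right lconj_cover star)
    show "x \<otimes>\<^bsub>cover\<^esub> y \<star>\<^bsub>cover\<^esub> z = lconj cover x (y \<star>\<^bsub>cover\<^esub> z) \<otimes>\<^bsub>cover\<^esub> (x \<star>\<^bsub>cover\<^esub> z)"
      using xyz by (simp add: lstar_mult_left lconj_cover star)
    show "(x \<star>\<^bsub>cover\<^esub> y) \<star>\<^bsub>cover\<^esub> lconj cover y z \<otimes>\<^bsub>cover\<^esub>
        ((y \<star>\<^bsub>cover\<^esub> z) \<star>\<^bsub>cover\<^esub> lconj cover z x) \<otimes>\<^bsub>cover\<^esub>
        ((z \<star>\<^bsub>cover\<^esub> x) \<star>\<^bsub>cover\<^esub> lconj cover x y) = \<one>\<^bsub>cover\<^esub>"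
      using xyz by (simp add: lstar_jacobi lconj_cover)
    show "lconj cover z (x \<star>\<^bsub>cover\<^esub> y) = lconj cover z x \<star>\<^bsub>cover\<^esub> lconj cover z y"
      using xyz by (simp add: lconj_lstar lconj_cover star)
    show "x \<star>\<^bsub>cover\<^esub> y \<in> carrier cover"
      using xyz by (simp add: star)
    show "x \<star>\<^bsub>cover\<^esub> x = \<one>\<^bsub>cover\<^esub>"
      using xyz by (simp add: lstar_self)
  qed
qed

sublocale K: mult_lie_algebra cover
  by (rule mult_lie_algebra_cover)

section \<open>The two projections of the cover\<close>

lemma snd_hom: "snd \<in> hom cover (free_Abelian_group (carrier G))"
  by (auto simp: hom_def carrier_cover_iff)

sublocale snd: group_hom cover "free_Abelian_group (carrier G)" snd
  using snd_hom by (simp add: group_hom_def group_hom_axioms_def K.is_group)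

text \<open>\<open>snd\<close> maps to an abelian group and is zero on every star, so its kernel
  contains all generators.\<close>

lemma snd_mlie_commutator_cover:
  assumes "x \<in> mlie_commutator cover" shows "snd x = 0"
proof -
  have "snd (commutator cover y z) = 0" if "y \<in> carrier cover" "z \<in> carrier cover" for y z
    using that K.lconj_eq_commutator[OF that] lconj_cover[of "fst y" "snd y" "fst z" "snd z"]
      snd.hom_mult[OF K.commutator_closed[OF that] that(2)]
    by simp
  moreover have "snd (y \<star>\<^bsub>cover\<^esub> z) = 0" for y z
    by (cases y; cases z) simp
  ultimately have "snd y = 0" if "y \<in> K.mlie_commutator_gens" for y
    using that unfolding K.mlie_commutator_gens_def by (elim UnE CollectE exE conjE) simp_all
  then have "K.mlie_commutator_gens \<subseteq> kernel cover (free_Abelian_group (carrier G)) snd"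
    using K.mlie_commutator_gens_carrier by (simp add: kernel_def subset_iff)
  then have "mlie_commutator cover \<subseteq> kernel cover (free_Abelian_group (carrier G)) snd"
    unfolding K.mlie_commutator_eq_generate
    by (rule K.generate_subgroup_incl[OF _ snd.subgroup_kernel])
  then show ?thesis
    using assms by (auto simp: kernel_def)
qed

sublocale fst: isoclinic_epi cover G fst
proof
  show "fst \<in> hom cover G"
    by (auto simp: hom_def carrier_cover_iff)
  show "fst (x \<star>\<^bsub>cover\<^esub> y) = fst x \<star> fst y" for x y
    by (cases x; cases y) simp
  have "(x, frag_of x) \<in> carrier cover" if "x \<in> carrier G" for x
    using that by (simp add: carrier_cover_iff h_frag_of)
  then have "carrier G \<subseteq> fst ` carrier cover"
    by (metis fst_conv image_eqI subsetI)
  then show "fst ` carrier cover = carrier G"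
    by (auto simp: carrier_cover_iff)
  show "x = \<one>\<^bsub>cover\<^esub>" if "x \<in> mlie_commutator cover" "fst x = \<one>" for x
    using that snd_mlie_commutator_cover by (simp add: prod_eq_iff)
qed

text \<open>The first component lifts to an element of \<open>mlie_commutator cover\<close>; the
  lift also has zero second component, so it equals \<open>x\<close>.\<close>

lemma in_mlie_commutator_cover:
  assumes "x \<in> carrier cover" "snd x = 0"
  shows "x \<in> mlie_commutator cover"
proof -
  have "fst x \<in> mlie_commutator G"
    using assms carrier_cover_zero_iff[of "fst x"] by (cases x) simp
  then obtain y where y: "y \<in> mlie_commutator cover" "fst x = fst y"
    unfolding fst.image_mlie_commutator[symmetric] by blast
  then have "x = y"
    using assms snd_mlie_commutator_cover by (simp add: prod_eq_iff)
  then show ?thesis using y by simp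
qed

section \<open>The stem algebra as a quotient of the cover\<close>

lemma ex_stem_isoclinic: "\<exists>H :: 'a mult_lie. mult_lie_algebra H \<and> stem H \<and> isoclinic G H"
proof -
  let ?Z = "mlie_center cover"
  let ?A = "cover\<lparr>carrier := ?Z\<rparr>"
  have "comm_group ?A"
    using K.mlie_center_comm K.mlie_center_carrier
    by (intro group.group_comm_groupI K.subgroup_imp_group K.mlie_center_subgroup) auto
  then interpret A: comm_group ?A .
  have "snd \<in> hom ?A (free_Abelian_group (carrier G))"
    using snd_hom K.mlie_center_carrier by (auto simp: hom_def)
  then obtain C where C: "subgroup C ?A" and C_ker: "\<And>c. \<lbrakk>c \<in> C; snd c = 0\<rbrakk> \<Longrightarrow> c = \<one>\<^bsub>?A\<^esub>"
    and C_img: "snd ` C = snd ` carrier ?A"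
    using A.hom_free_Abelian_group_complement by blast
  have CZ: "C \<subseteq> ?Z" using subgroup.subset[OF C] by simp
  have CK: "subgroup C cover"
    by (rule K.incl_subgroup[OF K.mlie_center_subgroup C])
  interpret C: subgroup C cover by (rule CK)
  interpret Z: subgroup ?Z cover by (rule K.mlie_center_subgroup)
  \<comment> \<open>The kernel of \<open>snd\<close> on the center. Dividing a central element by an
    element of \<open>C\<close> with the same second component moves it into \<open>?N\<close>, so
    \<open>C\<close> and \<open>?N\<close> together make up the center.\<close>
  let ?N = "{z \<in> ?Z. snd z = 0}"
  have CN: "\<exists>w\<in>?N. w \<in> C #>\<^bsub>cover\<^esub> z" if z: "z \<in> ?Z" for z
  proof -
    have "snd z \<in> snd ` C"
      unfolding C_img using z by simp
    then obtain c where c: "c \<in> C" "snd c = snd z" by force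
    let ?w = "inv\<^bsub>cover\<^esub> c \<otimes>\<^bsub>cover\<^esub> z"
    have "?w \<in> C #>\<^bsub>cover\<^esub> z" using c by (auto simp: r_coset_def)
    moreover have "snd ?w = inv\<^bsub>free_Abelian_group (carrier G)\<^esub> snd c \<otimes>\<^bsub>free_Abelian_group (carrier G)\<^esub> snd z"
      using c z by (simp del: mult_free_Abelian_group)
    then have "snd ?w = 0"
      using c z snd.hom_closed[of z] by simp
    moreover have "?w \<in> ?Z" using c z CZ by (auto intro: Z.m_closed)
    ultimately show ?thesis by blast
  qed
  have "inj_on fst ?N"
    by (rule inj_onI) (simp add: prod_eq_iff)
  then obtain q :: "'a \<times> ('a \<Rightarrow>\<^sub>0 int) \<Rightarrow> 'a" where
    q: "\<And>x y. \<lbrakk>x \<in> carrier cover; y \<in> carrier cover\<rbrakk> \<Longrightarrow>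
      q x = q y \<longleftrightarrow> C #>\<^bsub>cover\<^esub> x = C #>\<^bsub>cover\<^esub> y"
    using fst.central_coset_labelling[OF CK CZ _ _ CN] by (metis (no_types, lifting) mem_Collect_eq subsetI)
  \<comment> \<open>\<open>snd\<close> is zero on the multiplicative commutator but has trivial
    kernel on \<open>C\<close>. This makes the projection modulo \<open>C\<close> injective on the
    commutator.\<close>
  have "c = \<one>\<^bsub>cover\<^esub>" if "c \<in> C" "c \<in> mlie_commutator cover" for c
    using that C_ker snd_mlie_commutator_cover by simp
  then obtain H :: "'a mult_lie" where "isoclinic_epi cover H q"
    using K.central_quotient_realization[OF CK CZ _ q] by blast
  then interpret q: isoclinic_epi cover H q .
  have "stem H"
    unfolding stem_def
  proof
    fix u assume u: "u \<in> mlie_center H"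
    then obtain k where k: "k \<in> carrier cover" "u = q k"
      using q.cod.mlie_center_carrier q.surj by blast
    \<comment> \<open>A central element of \<open>H\<close> comes from a central element of the
      cover, which modulo \<open>C\<close> may be replaced by an element of \<open>?N\<close>, and
      \<open>?N\<close> lies in the multiplicative commutator.\<close>
    then have "k \<in> ?Z" using u q.mlie_center_iff by simp
    then obtain w where w: "w \<in> ?N" "w \<in> C #>\<^bsub>cover\<^esub> k" using CN by blast
    have wK: "w \<in> carrier cover" using w K.mlie_center_carrier by blast
    have qw: "q w = q k"
      using q[OF wK k(1)] K.repr_independence[OF w(2) k(1) CK] by simp
    have "w \<in> mlie_commutator cover"
      using w wK by (auto intro: in_mlie_commutator_cover)
    then have "q w \<in> mlie_commutator H"
      unfolding q.image_mlie_commutator[symmetric] by (rule imageI)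
    then show "u \<in> mlie_commutator H"
      using k qw by simp
  qed
  moreover have "isoclinic G H"
    by (rule isoclinic_span[OF fst.isoclinic_epi_axioms q.isoclinic_epi_axioms])
  ultimately show ?thesis
    using q.cod.mult_lie_algebra_axioms by blast
qed

end

theorem theorem2p15:
  fixes G :: "('a, 'm) mult_lie_scheme"
  assumes "mult_lie_algebra G"
  shows "\<exists>H :: 'a mult_lie. mult_lie_algebra H \<and> stem H \<and> isoclinic G H"
proof -
  interpret mult_lie_algebra G by fact
  interpret Q: comm_group "G Mod mlie_commutator G"
    by (rule mlie_abelianization_comm_group)
  have "(\<lambda>x. mlie_commutator G #>\<^bsub>G\<^esub> x) ` carrier G \<subseteq> carrier (G Mod mlie_commutator G)"
    by (simp add: carrier_FactGroup)
  then obtain h where "h \<in> hom (free_Abelian_group (carrier G)) (G Mod mlie_commutator G)"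
    "\<And>x. x \<in> carrier G \<Longrightarrow> h (frag_of x) = mlie_commutator G #>\<^bsub>G\<^esub> x"
    using Q.free_Abelian_group_universal by blast
  then interpret free_cover G h
    by unfold_locales
  show ?thesis by (rule ex_stem_isoclinic)
qed

end
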